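(* There exists a Hausdorff paratopological group $G$ in which every point is a $G_{\delta}$-set and such that $G$ is not submetrizable.
   Context: A paratopological group is a group $G$ with a topology such that the product map $G\times G\to G$ is jointly continuous. A space $X$ is submetrizable if it can be mapped onto a metric space by a continuous one-to-one map. A point $x$ is a $G_\delta$-set if $\{x\}$ is the intersection of countably many open sets. *)

theory Defs
  imports "HOL-Algebra.Group" "HOL-Analysis.Analysis"
begin

definition paratopological_group :: "('a, 'b) monoid_scheme \<Rightarrow> 'a topology \<Rightarrow> bool" where
  "paratopological_group G T \<longleftrightarrow>
     group G \<and> topspace T = carrier G \<and>
     continuous_map (prod_topology T T) T (\<lambda>(x, y). x \<otimes>\<^bsub>G\<^esub> y)"

text \<open>The metric space may be taken inside the type of the points of the space, because it is a
  bijective image of the space; lemma \<open>submetrizable_spaceI\<close> shows that no generality is lost.\<close>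

definition submetrizable_space :: "'a topology \<Rightarrow> bool" where
  "submetrizable_space X \<longleftrightarrow>
     (\<exists>(M :: 'a set) d f. Metric_space M d \<and>
        continuous_map X (Metric_space.mtopology M d) f \<and>
        inj_on f (topspace X) \<and> f ` topspace X = M)"

lemma submetrizable_spaceI:
  fixes X :: "'a topology" and M :: "'b set"
  assumes M: "Metric_space M d"
    and f: "continuous_map X (Metric_space.mtopology M d) f"
    and inj: "inj_on f (topspace X)" and surj: "f ` topspace X = M"
  shows "submetrizable_space X"
proof -
  interpret M: Metric_space M d by (rule M)
  define e where "e = (\<lambda>x y. if x \<in> topspace X \<and> y \<in> topspace X then d (f x) (f y) else 0)"
  have fM: "f x \<in> M" if "x \<in> topspace X" for x using surj that by blast
  interpret E: Metric_space "topspace X" e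
  proof
    show "0 \<le> e x y" for x y by (simp add: e_def)
    show "e x y = e y x" for x y by (simp add: e_def M.commute)
    show "e x y = 0 \<longleftrightarrow> x = y" if "x \<in> topspace X" "y \<in> topspace X" for x y
      using that inj fM by (auto simp: e_def inj_on_def)
    show "e x z \<le> e x y + e y z"
      if "x \<in> topspace X" "y \<in> topspace X" "z \<in> topspace X" for x y z
      using that fM M.triangle by (simp add: e_def)
  qed
  have "continuous_map X E.mtopology (\<lambda>x. x)"
    unfolding E.continuous_map_to_metric
  proof (intro ballI allI impI)
    fix x and r :: real
    assume x: "x \<in> topspace X" and r: "r > 0"
    obtain U where U: "openin X U" "x \<in> U" "\<And>y. y \<in> U \<Longrightarrow> f y \<in> M.mball (f x) r"
      using f x r unfolding M.continuous_map_to_metric by meson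
    have "\<forall>y\<in>U. y \<in> E.mball x r"
    proof
      fix y assume "y \<in> U"
      then have "y \<in> topspace X" "d (f x) (f y) < r"
        using U openin_subset[OF U(1)] by auto
      then show "y \<in> E.mball x r" using x unfolding E.in_mball by (simp add: e_def)
    qed
    with U show "\<exists>U. openin X U \<and> x \<in> U \<and> (\<forall>y\<in>U. y \<in> E.mball x r)" by blast
  qed
  then show ?thesis
    unfolding submetrizable_space_def
    by (intro exI[of _ "topspace X"] exI[of _ e] exI[of _ "\<lambda>x. x"])
       (simp add: E.Metric_space_axioms)
qed

end

theory Submission imports Defs begin

text \<open>Give \<open>\<real> \<times> K\<close>, where \<open>K\<close> is a Hausdorff group of uncountable pseudocharacter, the
  neighbourhoods \<open>{0} \<union> (0, \<epsilon>) \<times> W\<close> of the identity. The first coordinate alone makes points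
  \<open>G\<^sub>\<delta>\<close>. A map to a metric space is controlled, at the countably many points with rational first
  coordinate and trivial second coordinate, by countably many \<open>\<epsilon>\<close> and \<open>W\<close>. By the Baire theorem
  some \<open>s\<close> lies, for every precision, in one of the intervals \<open>(t, t + \<epsilon>)\<close>, while some \<open>k \<noteq> 0\<close> lies
  in all the \<open>W\<close>; the map then cannot separate \<open>(s, 0)\<close> from \<open>(s, k)\<close>.

  Here \<open>\<real> \<times> K\<close> is the group of all functions \<open>real \<Rightarrow> real\<close>: the first factor is the value at
  \<open>0\<close>, and \<open>K\<close> is the power of the discrete reals over the nonzero arguments.\<close>

text \<open>For finite \<open>F\<close> and positive \<open>\<epsilon>\<close> this is the translate
  by \<open>g\<close> of a basic neighbourhood of the identity. The guard
  \<open>i \<noteq> 0\<close> lets \<open>F\<close> be any finite set: agreement at \<open>0\<close>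
  would empty the strip.\<close>

definition wedge :: "(real \<Rightarrow> real) \<Rightarrow> real \<Rightarrow> real set \<Rightarrow> (real \<Rightarrow> real) set" where
  "wedge g \<epsilon> F = insert g {h. g 0 < h 0 \<and> h 0 < g 0 + \<epsilon> \<and> (\<forall>i\<in>F. i \<noteq> 0 \<longrightarrow> h i = g i)}"

lemma wedge_mono: "\<lbrakk>\<epsilon> \<le> \<delta>; F \<subseteq> F'\<rbrakk> \<Longrightarrow> wedge g \<epsilon> F' \<subseteq> wedge g \<delta> F"
  by (auto simp: wedge_def)

lemma self_in_wedge: "g \<in> wedge g \<epsilon> F"
  by (simp add: wedge_def)

text \<open>Excesses in the first coordinate add up, and agreement on \<open>F\<close> survives
  addition. A summand equal to its own centre has excess \<open>0\<close>, which keeps the total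
  below \<open>\<epsilon>\<close>.\<close>

lemma wedge_add:
  assumes "g' \<in> wedge g (\<epsilon> / 2) F" "h' \<in> wedge h (\<epsilon> / 2) F" "\<epsilon> > 0"
  shows "(\<lambda>x. g' x + h' x) \<in> wedge (\<lambda>x. g x + h x) \<epsilon> F"
  using assms by (auto simp: wedge_def)

definition wedge_topology :: "(real \<Rightarrow> real) topology" where
  "wedge_topology = topology (\<lambda>U. \<forall>g\<in>U. \<exists>\<epsilon>>0. \<exists>F. finite F \<and> wedge g \<epsilon> F \<subseteq> U)"

lemma openin_wedge_topology:
  "openin wedge_topology U \<longleftrightarrow> (\<forall>g\<in>U. \<exists>\<epsilon>>0. \<exists>F. finite F \<and> wedge g \<epsilon> F \<subseteq> U)"
proof -
  let ?P = "\<lambda>U. \<forall>g\<in>U. \<exists>\<epsilon>>0. \<exists>F. finite F \<and> wedge g \<epsilon> F \<subseteq> U"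
  have Int: "?P (S \<inter> T)" if S: "?P S" and T: "?P T" for S T
  proof
    fix g assume "g \<in> S \<inter> T"
    then obtain \<epsilon> F \<delta> E where "\<epsilon> > 0" "finite F" "wedge g \<epsilon> F \<subseteq> S"
      and "\<delta> > 0" "finite E" "wedge g \<delta> E \<subseteq> T"
      using S T by (metis IntD1 IntD2)
    then have "min \<epsilon> \<delta> > 0" "finite (F \<union> E)" "wedge g (min \<epsilon> \<delta>) (F \<union> E) \<subseteq> S \<inter> T"
      using wedge_mono[of "min \<epsilon> \<delta>" \<epsilon> F "F \<union> E" g] wedge_mono[of "min \<epsilon> \<delta>" \<delta> E "F \<union> E" g]
      by auto
    then show "\<exists>\<epsilon>>0. \<exists>F. finite F \<and> wedge g \<epsilon> F \<subseteq> S \<inter> T" by blast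
  qed
  have Union: "?P (\<Union>\<K>)" if \<K>: "\<And>K. K \<in> \<K> \<Longrightarrow> ?P K" for \<K>
  proof
    fix g assume "g \<in> \<Union>\<K>"
    then obtain K where "K \<in> \<K>" "g \<in> K" by blast
    with \<K>[OF this(1)] show "\<exists>\<epsilon>>0. \<exists>F. finite F \<and> wedge g \<epsilon> F \<subseteq> \<Union>\<K>"
      by (meson Sup_upper subset_trans)
  qed
  have "istopology ?P"
    unfolding istopology_def
  proof (intro conjI allI impI)
    show "?P (S \<inter> T)" if "?P S" "?P T" for S T
      using that by (rule Int)
    show "?P (\<Union>\<K>)" if "\<forall>K\<in>\<K>. ?P K" for \<K>
      using that by (intro Union) (rule bspec)
  qed
  then show ?thesis
    unfolding wedge_topology_def by (simp only: topology_inverse')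
qed

lemma topspace_wedge_topology [simp]: "topspace wedge_topology = UNIV"
proof -
  have "openin wedge_topology UNIV"
    unfolding openin_wedge_topology using zero_less_one by blast
  then show ?thesis using openin_subset by blast
qed

lemma openin_wedge:
  assumes "\<epsilon> > 0" "finite F"
  shows "openin wedge_topology (wedge g \<epsilon> F)"
  unfolding openin_wedge_topology
proof
  fix h assume h: "h \<in> wedge g \<epsilon> F"
  show "\<exists>\<delta>>0. \<exists>E. finite E \<and> wedge h \<delta> E \<subseteq> wedge g \<epsilon> F"
  proof (cases "h = g")
    case True
    then show ?thesis using assms by blast
  next
    case False
    \<comment> \<open>The new length is what remains of the strip to the right of
      \<open>h 0\<close>. Agreement with \<open>h\<close> on \<open>F\<close> away from
      \<open>0\<close> is agreement with \<open>g\<close> there.\<close>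
    with h have "g 0 + \<epsilon> - h 0 > 0" "wedge h (g 0 + \<epsilon> - h 0) F \<subseteq> wedge g \<epsilon> F"
      by (auto simp: wedge_def)
    then show ?thesis using assms(2) by blast
  qed
qed

abbreviation function_group :: "(real \<Rightarrow> real) monoid" where
  "function_group \<equiv> \<lparr>carrier = UNIV, monoid.mult = (\<lambda>g h x. g x + h x), monoid.one = (\<lambda>x. 0)\<rparr>"

lemma group_function_group: "group function_group"
proof (rule groupI)
  fix g :: "real \<Rightarrow> real"
  have "(\<lambda>x. - g x + g x) = (\<lambda>x. 0)" by simp
  then show "\<exists>h\<in>carrier function_group. h \<otimes>\<^bsub>function_group\<^esub> g = \<one>\<^bsub>function_group\<^esub>"
    by (intro bexI[of _ "\<lambda>x. - g x"]) auto
qed (simp_all add: add.assoc)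

lemma paratopological_group_wedge: "paratopological_group function_group wedge_topology"
proof -
  let ?add = "\<lambda>(g, h) x. g x + h x :: real"
  have "openin (prod_topology wedge_topology wedge_topology) (?add -` U)"
    if U: "openin wedge_topology U" for U
    unfolding openin_prod_topology_alt
  proof (intro allI impI)
    fix g h assume "(g, h) \<in> ?add -` U"
    then obtain \<epsilon> F where \<epsilon>: "\<epsilon> > 0" "finite F" and sub: "wedge (\<lambda>x. g x + h x) \<epsilon> F \<subseteq> U"
      using U unfolding openin_wedge_topology by fastforce
    have "wedge g (\<epsilon> / 2) F \<times> wedge h (\<epsilon> / 2) F \<subseteq> ?add -` U"
      using wedge_add[OF _ _ \<epsilon>(1)] sub by fastforce
    moreover have "openin wedge_topology (wedge k (\<epsilon> / 2) F)" for k
      using \<epsilon> by (simp add: openin_wedge)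
    ultimately show "\<exists>V W. openin wedge_topology V \<and> openin wedge_topology W \<and>
        g \<in> V \<and> h \<in> W \<and> V \<times> W \<subseteq> ?add -` U"
      by (intro exI conjI) (rule self_in_wedge | assumption)+
  qed
  then have "continuous_map (prod_topology wedge_topology wedge_topology) wedge_topology ?add"
    by (simp add: continuous_map_def vimage_def)
  then show ?thesis
    unfolding paratopological_group_def using group_function_group by simp
qed

lemma Hausdorff_wedge_topology: "Hausdorff_space wedge_topology"
  unfolding Hausdorff_space_def
proof (intro allI impI)
  fix g h :: "real \<Rightarrow> real"
  assume "g \<in> topspace wedge_topology \<and> h \<in> topspace wedge_topology \<and> g \<noteq> h"
  then obtain i where i: "g i \<noteq> h i" by auto
  \<comment> \<open>If the first coordinates differ, the left strip stops short of the larger one,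
    where the other wedge starts. If they are equal, then \<open>i\<close> is nonzero and the values
    at \<open>i\<close> separate the strips, while neither centre lies in the other strip.\<close>
  define \<epsilon> where "\<epsilon> = (if g 0 = h 0 then 1 else \<bar>g 0 - h 0\<bar>)"
  have "\<epsilon> > 0" by (simp add: \<epsilon>_def)
  moreover have "disjnt (wedge g \<epsilon> {i}) (wedge h \<epsilon> {i})"
    using i by (auto simp: wedge_def disjnt_def \<epsilon>_def abs_if split: if_splits)
  ultimately show "\<exists>U V. openin wedge_topology U \<and> openin wedge_topology V \<and>
      g \<in> U \<and> h \<in> V \<and> disjnt U V"
    by (meson finite.emptyI finite.insertI openin_wedge self_in_wedge)
qed

lemma gdelta_in_wedge_topology: "gdelta_in wedge_topology {g}"
proof -
  let ?\<G> = "range (\<lambda>n. wedge g (inverse (real (Suc n))) {})"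
  have "h = g" if h: "\<And>n. h \<in> wedge g (inverse (real (Suc n))) {}" for h
  proof (rule ccontr)
    assume "h \<noteq> g"
    with h have "h 0 - g 0 > 0" and *: "\<And>n. h 0 < g 0 + inverse (real (Suc n))"
      unfolding wedge_def by auto
    then obtain n where "inverse (real (Suc n)) < h 0 - g 0"
      using reals_Archimedean by blast
    with *[of n] show False by simp
  qed
  then have "\<Inter>?\<G> = {g}" using self_in_wedge by fastforce
  moreover have "gdelta_in wedge_topology (\<Inter>?\<G>)"
    by (intro gdelta_in_Inter) (auto intro!: open_imp_gdelta_in openin_wedge)
  ultimately show ?thesis by simp
qed

text \<open>For fixed \<open>n\<close> the union of the intervals over \<open>q\<close> is open, and
  dense because it has points immediately to the right of every rational. Baire yields a single
  \<open>s\<close> for all \<open>n\<close>, while \<open>q\<close> may vary with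
  \<open>n\<close>.\<close>

lemma Baire_right_intervals:
  fixes \<epsilon> :: "nat \<Rightarrow> rat \<Rightarrow> real"
  assumes pos: "\<And>n q. \<epsilon> n q > 0"
  obtains s where "\<And>n. \<exists>q. of_rat q < s \<and> s < of_rat q + \<epsilon> n q"
proof -
  define I where "I n = (\<Union>q. {of_rat q <..< of_rat q + \<epsilon> n q})" for n
  have dense_I: "x \<in> closure (I n)" for x n
    unfolding closure_approachable
  proof (intro allI impI)
    fix e :: real assume "e > 0"
    then obtain q where q: "x < of_rat q" "of_rat q < x + e"
      using of_rat_dense[of x "x + e"] by auto
    obtain y where y: "of_rat q < y" "y < min (of_rat q + \<epsilon> n q) (x + e)"
      using dense[of "of_rat q" "min (of_rat q + \<epsilon> n q) (x + e)"] q pos by auto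
    then have "y \<in> I n" "dist y x < e"
      using q by (auto simp: I_def dist_real_def)
    then show "\<exists>y\<in>I n. dist y x < e" by blast
  qed
  have "UNIV \<subseteq> closure (\<Inter>(range I))"
  proof (rule Baire)
    fix T assume "T \<in> range I"
    then show "openin (top_of_set UNIV) T \<and> UNIV \<subseteq> closure T"
      using dense_I unfolding I_def by auto
  qed auto
  then have "\<Inter>(range I) \<noteq> {}" by auto
  then show thesis using that unfolding I_def by fastforce
qed

lemma not_submetrizable_wedge_topology: "\<not> submetrizable_space wedge_topology"
proof
  assume "submetrizable_space wedge_topology"
  then obtain M :: "(real \<Rightarrow> real) set" and d f where M: "Metric_space M d"
    and f: "continuous_map wedge_topology (Metric_space.mtopology M d) f"
    and inj: "inj f"
    unfolding submetrizable_space_def by auto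
  interpret Metric_space M d by (rule M)
  have "\<exists>\<epsilon> F. \<epsilon> > 0 \<and> finite F \<and>
      (\<forall>h \<in> wedge g \<epsilon> F. f h \<in> mball (f g) (inverse (real (Suc n))))" for g n
  proof -
    have "inverse (real (Suc n)) > 0" by simp
    then obtain U where "openin wedge_topology U" "g \<in> U"
      "\<forall>h\<in>U. f h \<in> mball (f g) (inverse (real (Suc n)))"
      using f unfolding continuous_map_to_metric by (metis UNIV_I topspace_wedge_topology)
    then show ?thesis unfolding openin_wedge_topology by (meson subsetD)
  qed
  then obtain \<epsilon> F where \<epsilon>: "\<And>g n. \<epsilon> g n > 0" and F: "\<And>g n. finite (F g n)"
    and ball: "\<And>g n h. h \<in> wedge g (\<epsilon> g n) (F g n) \<Longrightarrow> f h \<in> mball (f g) (inverse (real (Suc n)))"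
    by metis
  \<comment> \<open>\<open>c t\<close> is the point with first coordinate \<open>t\<close> and
    trivial component in \<open>K\<close>.\<close>
  define c :: "real \<Rightarrow> real \<Rightarrow> real" where "c t = (\<lambda>x. 0)(0 := t)" for t
  obtain s where s: "\<And>n. \<exists>q. of_rat q < s \<and> s < of_rat q + \<epsilon> (c (of_rat q)) n"
    using Baire_right_intervals[of "\<lambda>n q. \<epsilon> (c (of_rat q)) n"] \<epsilon> by blast
  \<comment> \<open>\<open>A\<close> collects every coordinate constrained at a rational point, a
    countable union of finite sets, so some \<open>i\<close> is free throughout. Excluding
    \<open>0\<close> as well ensures that changing the value at \<open>i\<close> keeps the first
    coordinate \<open>s\<close>.\<close>
  define A where "A = (\<Union>q n. F (c (of_rat q)) n)"
  have "countable (insert 0 A)"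
    unfolding A_def using F by (intro countable_insert countable_UN) (auto intro: countable_finite)
  then obtain i where "i \<notin> insert 0 A"
    using uncountable_UNIV_real by (metis UNIV_eq_I)
  then have "i \<noteq> 0" and A: "i \<notin> A" by auto
  have "d (f (c s)) (f ((c s)(i := 1))) < 2 * inverse (real (Suc n))" for n
  proof -
    obtain q where q: "of_rat q < s" "s < of_rat q + \<epsilon> (c (of_rat q)) n" using s by blast
    let ?g = "c (of_rat q)"
    have "i \<notin> F ?g n" using A unfolding A_def by blast
    \<comment> \<open>Both points have first coordinate \<open>s\<close>, inside the strip of
      \<open>?g\<close>, and vanish on \<open>F ?g n\<close> away from \<open>0\<close> as
      \<open>?g\<close> does. Passing through \<open>f ?g\<close> costs one radius for each point,
      hence the factor 2.\<close>
    then have "c s \<in> wedge ?g (\<epsilon> ?g n) (F ?g n)" "(c s)(i := 1) \<in> wedge ?g (\<epsilon> ?g n) (F ?g n)"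
      using q \<open>i \<noteq> 0\<close> by (auto simp: wedge_def c_def)
    from this[THEN ball] show ?thesis
      using triangle'[of "f (c s)" "f ?g" "f ((c s)(i := 1))"] by (auto simp: commute)
  qed
  then have "\<not> 0 < d (f (c s)) (f ((c s)(i := 1)))"
    using reals_Archimedean[of "d (f (c s)) (f ((c s)(i := 1))) / 2"]
    by (smt (verit) field_sum_of_halves half_gt_zero)
  moreover have "f g \<in> M" for g
    using ball[OF self_in_wedge] by (meson in_mball)
  ultimately have "f (c s) = f ((c s)(i := 1))" by (metis mdist_pos_eq)
  then have "c s i = ((c s)(i := 1)) i" using inj by (metis injD)
  then show False using \<open>i \<noteq> 0\<close> by (simp add: c_def)
qed

theorem mainTheorem1:
  "\<exists>(G :: (real \<Rightarrow> real) monoid) (T :: (real \<Rightarrow> real) topology).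
     paratopological_group G T \<and>
     Hausdorff_space T \<and>
     (\<forall>x \<in> carrier G. gdelta_in T {x}) \<and>
     \<not> submetrizable_space T"
  using paratopological_group_wedge Hausdorff_wedge_topology gdelta_in_wedge_topology
    not_submetrizable_wedge_topology by blast

end
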